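(* Let $q$ be an odd prime power with $q\ge 5$ and let $n\ge 2$ be an integer. Let $\mathcal{F}_{q,n}$ be the class of maps $F:\mathbb{F}_q\to\mathbb{F}_q$ defined in the context. Then the spectrum of $\mathcal{F}_{q,n}$ satisfies $$v(\mathcal{F}_{q,n})\subseteq \{2,3,\ldots,n+1,\ q-n,q-n+1,\ldots,q-2,\ q\}.$$
   Context: Construction of $\mathcal{F}_{q,n}$: for $a,b\in\mathbb{F}_q^*$ put $g(x)=ax+b$, and let $\mathbf{O}_n=\{x_1,\ldots,x_n\}$ be a set of $n$ distinct elements of $\mathbb{F}_q$ with $x_1=0$ and $x_n=-b/a$. Define the permutation $f$ of $\mathbb{F}_q$ by $f(x)=g(x)$ for $x\notin\mathbf{O}_n$, $f(x_i)=g(x_{i-1})$ for $2\le i\le n$, and $f(x_1)=g(x_n)=0$. Put $F(x)=f(x)+x$; equivalently $F(\delta)=(a+1)\delta+b$ for $\delta\notin\mathbf{O}_n$, $F(x_i)=ax_{i-1}+x_i+b$ for $2\le i\le n$, and $F(0)=0$. The class $\mathcal{F}_{q,n}$ consists of all such $F$ (identified with their reduced polynomials of degree $\le q-1$), as $a,b\in\mathbb{F}_q^*$ and $\mathbf{O}_n$ vary. The value set of $F$ is $V_F=\{F(c):c\in\mathbb{F}_q\}$, and the spectrum of a class $\mathcal{C}$ is $v(\mathcal{C})=\{|V_F|:F\in\mathcal{C}\}$. *)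

theory Defs
  imports Complex_Main "HOL-Library.Cardinality"
begin

text \<open>
  The field with q elements is a type of classes field and finite, with q its cardinality.
  The set \<open>{x 1, \<dots>, x n}\<close> comes with its enumeration x; only the values of x
  on \<open>{1..n}\<close> are relevant.
\<close>

definition orbit_enum :: "'a::field \<Rightarrow> 'a \<Rightarrow> nat \<Rightarrow> (nat \<Rightarrow> 'a) \<Rightarrow> bool" where
  "orbit_enum a b n x \<longleftrightarrow> inj_on x {1..n} \<and> x 1 = 0 \<and> x n = - b / a"

definition shifted_affine :: "'a::field \<Rightarrow> 'a \<Rightarrow> nat \<Rightarrow> (nat \<Rightarrow> 'a) \<Rightarrow> ('a \<Rightarrow> 'a) \<Rightarrow> bool" where
  "shifted_affine a b n x f \<longleftrightarrow>
     (\<forall>t. t \<notin> x ` {1..n} \<longrightarrow> f t = a * t + b) \<and>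
     (\<forall>i\<in>{2..n}. f (x i) = a * x (i - 1) + b) \<and>
     f (x 1) = a * x n + b"

text \<open>The conditions in \<open>shifted_affine\<close> determine f.\<close>

lemma shifted_affine_ex1:
  assumes "orbit_enum a b n x" "n \<ge> 2"
  shows "\<exists>!f. shifted_affine a b n x f"
proof (rule ex_ex1I)
  let ?k = "the_inv_into {1..n} x"
  let ?f = "\<lambda>t. if t \<notin> x ` {1..n} then a * t + b
                else if ?k t = 1 then a * x n + b else a * x (?k t - 1) + b"
  have inj: "inj_on x {1..n}"
    using assms by (simp add: orbit_enum_def)
  have k: "?k (x i) = i" if "i \<in> {1..n}" for i
    using the_inv_into_f_f[OF inj that] .
  have "?f (x i) = a * x (i - 1) + b" if "i \<in> {2..n}" for i
    using that k[of i] by auto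
  moreover have "?f (x 1) = a * x n + b"
    using assms k[of 1] by auto
  ultimately have "shifted_affine a b n x ?f"
    unfolding shifted_affine_def by simp
  then show "\<exists>f. shifted_affine a b n x f" by blast
next
  fix f g
  assume f: "shifted_affine a b n x f" and g: "shifted_affine a b n x g"
  show "f = g"
  proof
    fix t
    consider "t \<notin> x ` {1..n}" | "t = x 1" | i where "i \<in> {2..n}" "t = x i"
    proof (cases "t \<in> x ` {1..n}")
      case True
      then obtain i where i: "i \<in> {1..n}" "t = x i" by blast
      show ?thesis
        using that(2) that(3)[of i] i by (cases "i = 1") auto
    qed (use that in blast)
    then show "f t = g t"
      using f g by cases (auto simp: shifted_affine_def)
  qed
qed

definition F_class :: "nat \<Rightarrow> ('a::field \<Rightarrow> 'a) set" where
  "F_class n = {F. \<exists>a b x f. a \<noteq> 0 \<and> b \<noteq> 0 \<and> orbit_enum a b n x \<and>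
                      shifted_affine a b n x f \<and> F = (\<lambda>t. f t + t)}"

definition value_set :: "('a \<Rightarrow> 'a) \<Rightarrow> 'a set" where
  "value_set F = {F c | c. c \<in> UNIV}"

definition spectrum :: "('a \<Rightarrow> 'a) set \<Rightarrow> nat set" where
  "spectrum C = {card (value_set F) | F. F \<in> C}"

end

theory Submission imports Defs begin

text \<open>
  If \<open>a = -1\<close>, then \<open>F\<close> is constantly \<open>b\<close> off \<open>\<bold>O\<^sub>n\<close>, which leaves at most \<open>n + 1\<close> values, and
  both 0 and \<open>b\<close> occur unless \<open>n = q\<close>. If \<open>a \<noteq> -1\<close>, then \<open>F\<close> is injective off \<open>\<bold>O\<^sub>n\<close>, so there are at
  least \<open>q - n\<close> values. The number of values is never \<open>q - 1\<close>: as \<open>f\<close> is a permutation and the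
  elements of a field with more than two elements sum to 0, the values of \<open>F\<close> sum to 0 over the
  field; but if \<open>F\<close> took one value \<open>w\<close> twice and missed only \<open>u\<close>, this sum would be \<open>w - u \<noteq> 0\<close>.
\<close>

text \<open>Multiplication by some \<open>c\<close> other than 0 and 1 permutes the field, so the
  sum S satisfies c S = S and must vanish.\<close>

lemma sum_UNIV_finite_field:
  assumes "CARD('a::{field,finite}) > 2"
  shows "(\<Sum>t\<in>UNIV. t :: 'a) = 0"
proof -
  have "card {0, 1 :: 'a} < CARD('a)"
    using assms by simp
  then have "{0, 1 :: 'a} \<noteq> UNIV"
    by (metis less_irrefl)
  then obtain c :: 'a where c: "c \<noteq> 0" "c \<noteq> 1"
    by blast
  have "bij ((*) c)"
    by (rule bij_betw_byWitness[where f' = "\<lambda>t. t / c"]) (use c in auto)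
  then have "(\<Sum>t\<in>UNIV. c * t) = (\<Sum>t\<in>UNIV. t)"
    by (rule sum.reindex_bij_betw[where g = "\<lambda>t. t"])
  then have "(c - 1) * (\<Sum>t\<in>UNIV. t) = 0"
    by (simp add: left_diff_distrib sum_distrib_left[symmetric])
  with c show ?thesis by simp
qed

lemma card_range_neq_if_sum_eq:
  fixes F :: "'a::{finite,ab_group_add} \<Rightarrow> 'a"
  assumes sum: "sum F UNIV = (\<Sum>t\<in>UNIV. t)"
  shows "card (range F) \<noteq> CARD('a) - 1"
proof
  assume card: "card (range F) = CARD('a) - 1"
  have "0 < CARD('a)" by (simp add: finite_UNIV_card_ge_0)
  with card have "card (range F) \<noteq> CARD('a)"
    by linarith
  then have "\<not> inj F"
    using card_image by blast
  then obtain c d where cd: "c \<noteq> d" "F c = F d"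
    unfolding inj_def by blast
  \<comment> \<open>Since \<open>d\<close> takes the same value as \<open>c\<close>, dropping
    \<open>c\<close> loses no value. The remaining \<open>CARD('a) - 1\<close> arguments take
    equally many values, so \<open>F\<close> is injective on them.\<close>
  have img: "F ` (UNIV - {c}) = range F"
  proof
    show "range F \<subseteq> F ` (UNIV - {c})"
    proof
      fix y assume "y \<in> range F"
      then obtain t where "y = F t" by blast
      with cd show "y \<in> F ` (UNIV - {c})"
        by (cases "t = c") auto
    qed
  qed auto
  then have inj: "inj_on F (UNIV - {c})"
    using card by (intro eq_card_imp_inj_on) auto
  have "card (UNIV - range F) = 1"
    using card \<open>0 < CARD('a)\<close> by (simp add: card_Diff_subset)
  then obtain u where u: "UNIV - range F = {u}"
    by (auto simp: card_1_singleton_iff)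
  then have range: "range F = UNIV - {u}" by blast
  have "sum F UNIV = F c + sum F (UNIV - {c})"
    by (simp add: sum.remove)
  also have "sum F (UNIV - {c}) = (\<Sum>t\<in>UNIV - {u}. t)"
    using sum.reindex[OF inj, of "\<lambda>t. t"] img range by simp
  also have "\<dots> = (\<Sum>t\<in>UNIV. t) - u"
    by (simp add: sum_diff1)
  finally have "F c = u"
    using sum by (simp add: algebra_simps)
  with range show False by blast
qed

text \<open>On a finite type surjectivity suffices, and preimages are explicit because
  \<open>f\<close> is a cyclic shift of the \<open>x i\<close> followed by an affine
  bijection.\<close>

lemma shifted_affine_bij:
  fixes f :: "'a::{field,finite} \<Rightarrow> 'a"
  assumes f: "shifted_affine a b n x f" and a: "a \<noteq> 0"
  shows "bij f"
proof -
  have "y \<in> range f" for y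
  proof -
    define t where "t = (y - b) / a"
    have y: "y = a * t + b"
      using a by (simp add: t_def)
    show ?thesis
    proof (cases "t \<in> x ` {1..n}")
      case False
      then have "y = f t"
        using f y by (simp add: shifted_affine_def)
      then show ?thesis by blast
    next
      case True
      then obtain i where i: "i \<in> {1..n}" "t = x i" by blast
      \<comment> \<open>The preimage is the cyclic successor of \<open>x i\<close>; index
        \<open>n\<close> wraps around to 1.\<close>
      have "y = f (x (if i = n then 1 else i + 1))"
        using f y i by (simp add: shifted_affine_def)
      then show ?thesis by blast
    qed
  qed
  then have "surj f" by blast
  then show ?thesis
    by (simp add: bij_def finite_UNIV_surj_inj)
qed

lemma card_range_add_id_neq:
  fixes f :: "'a::{field,finite} \<Rightarrow> 'a"
  assumes "bij f" "CARD('a) > 2"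
  shows "card (range (\<lambda>t. f t + t)) \<noteq> CARD('a) - 1"
proof (rule card_range_neq_if_sum_eq)
  have "sum f UNIV = (\<Sum>t\<in>UNIV. t)"
    using sum.reindex_bij_betw[OF assms(1), of "\<lambda>t. t"] by simp
  then show "(\<Sum>t\<in>UNIV. f t + t) = (\<Sum>t\<in>UNIV. t)"
    using sum_UNIV_finite_field[OF assms(2)] by (simp add: sum.distrib)
qed

theorem theorem1:
  fixes q n :: nat
  assumes "CARD('a::{field,finite}) = q"
    and "odd q" and "q \<ge> 5" and "n \<ge> 2"
  shows "spectrum (F_class n :: ('a \<Rightarrow> 'a) set) \<subseteq> {2..n + 1} \<union> {q - n..q - 2} \<union> {q}"
proof
  fix k assume "k \<in> spectrum (F_class n :: ('a \<Rightarrow> 'a) set)"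
  then obtain a b :: 'a and x f where a: "a \<noteq> 0" and b: "b \<noteq> 0"
    and x: "orbit_enum a b n x" and f: "shifted_affine a b n x f"
    and k: "k = card (range (\<lambda>t. f t + t))"
    by (auto simp: spectrum_def F_class_def value_set_def full_SetCompr_eq)
  define F where "F = (\<lambda>t. f t + t)"
  define O_n where "O_n = x ` {1..n}"
  have card_O: "card O_n = n"
    using x by (simp add: O_n_def orbit_enum_def card_image)
  have k_ne: "k \<noteq> q - 1"
    using card_range_add_id_neq[OF shifted_affine_bij[OF f a]] assms k by simp
  have k_le: "k \<le> q"
    using assms(1) k by (metis card_image_le finite)
  have F_off: "F t = (a + 1) * t + b" if "t \<notin> O_n" for t
    using f that by (simp add: F_def O_n_def shifted_affine_def algebra_simps)
  show "k \<in> {2..n + 1} \<union> {q - n..q - 2} \<union> {q}"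
  \<comment> \<open>The first case needs a point outside \<open>O_n\<close>. If
    \<open>n \<ge> q\<close>, truncated subtraction gives \<open>q - n = 0\<close>, so the lower
    bound of the second case is trivial even for \<open>a = - 1\<close>.\<close>
  proof (cases "a = - 1 \<and> n < q")
    case True
    have "range F \<subseteq> insert b (F ` O_n)"
      using F_off True by auto
    then have "k \<le> card (insert b (F ` O_n))"
      unfolding k F_def by (intro card_mono) auto
    also have "\<dots> \<le> Suc (card (F ` O_n))"
      by (rule card_insert_le_m1) auto
    also have "\<dots> \<le> n + 1"
      using card_image_le[of O_n F] card_O by simp
    finally have upper: "k \<le> n + 1" .
    have "O_n \<noteq> UNIV"
      using card_O True assms(1) by auto
    then obtain t where "t \<notin> O_n" by blast
    then have "F t = b"
      using F_off True by simp
    \<comment> \<open>Here \<open>x 1 = 0\<close> and \<open>x n = - b / a\<close> enter: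
      \<open>f 0 = a * x n + b = 0\<close>.\<close>
    moreover have "F 0 = 0"
      using f x a by (simp add: F_def shifted_affine_def orbit_enum_def)
    ultimately have "{0, b} \<subseteq> range F"
      by (metis empty_subsetI insert_subset rangeI)
    then have "card {0, b} \<le> k"
      unfolding k F_def by (intro card_mono) auto
    with b upper show ?thesis by simp
  next
    case False
    have "q - n \<le> k"
    proof (cases "n < q")
      case n: True
      have "inj_on F (- O_n)"
      proof (rule inj_onI)
        fix s t assume "s \<in> - O_n" "t \<in> - O_n" "F s = F t"
        then have "(a + 1) * s = (a + 1) * t"
          using F_off by simp
        then show "s = t"
          \<comment> \<open>With \<open>n < q\<close> the failed case condition leaves
            \<open>a \<noteq> - 1\<close>, so \<open>a + 1\<close> cancels.\<close>
          using False n by (simp add: add_eq_0_iff2)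
      qed
      then have "card (F ` (- O_n)) = q - n"
        using card_O assms(1) by (simp add: card_image Compl_eq_Diff_UNIV card_Diff_subset)
      moreover have "card (F ` (- O_n)) \<le> k"
        unfolding k F_def by (intro card_mono) auto
      ultimately show ?thesis by simp
    qed simp
    with k_ne k_le show ?thesis by auto
  qed
qed

end
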